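(* Let $0<\epsilon<\frac12$, let $c\ge1$ be the number of cores, $K>0$ the total cache, and $J$ a set of jobs with non-increasing load functions $T_j$. Let $p$ be any cache partition of at most $K$ cache among the $c$ cores and $S$ any assignment of the jobs in $J$ to the cores. Then there exist a cache partition $\hat p$ determined by a pair in $P(K,c,\epsilon)$ and a job assignment $\hat S$ such that $M(\hat p,\hat S)\le 9M(p,S)$.
   Context: Joint cache partition and job assignment: each job $j\in J$ has a non-increasing function $T_j:[0,\infty)\to(0,\infty]$ giving its running time on a core with $x$ cache. A cache partition $p$ assigns $p(i)\ge0$ cache to core $i\in\{1,\dots,c\}$; an assignment $S$ maps jobs to cores; the makespan is $M(p,S)=\max_i\sum_{j:S(j)=i}T_j(p(i))$. Let $K'=(1+\epsilon)^{\lceil\log_{1+\epsilon}K\rceil}$. The set $P(K,c,\epsilon)$ consists of all pairs $(l,\hat\sigma)$ with $l=\langle l_1,\dots,l_b\rangle$ and $\hat\sigma=\langle\hat\sigma_0,\hat\sigma_1,\dots,\hat\sigma_b\rangle$ such that: $b$ is an integer with $1\le b\le\lfloor\log_2 c\rfloor+1$; each $l_j$ is an integer with $0\le l_j\le\log_{1+\epsilon}(c/\epsilon)+1$ and $l_{j+1}>l_j$; $\hat\sigma_0=0$, each $\hat\sigma_j$ ($j\ge1$) is an integral power of $2$, $\hat\sigma_{j+1}>\hat\sigma_j$, $\hat\sigma_b\le c$; and $\sum_{j=1}^b(\hat\sigma_j-\hat\sigma_{j-1})\frac{K'}{(1+\epsilon)^{l_j}}\le(1+\frac52\epsilon)K$.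 The cache partition determined by such a pair gives, for each $j=1,\dots,b$, cache $\frac{K'}{(1+\epsilon)^{l_j}}$ to $\hat\sigma_j-\hat\sigma_{j-1}$ of the cores, and cache $0$ to the remaining $c-\hat\sigma_b$ cores. *)

theory Defs
  imports Complex_Main "HOL-Library.Extended_Nonnegative_Real" "HOL-Library.FuncSet"
begin

text \<open>Cores are the numbers \<open>1, \<dots>, c\<close>. Running times are in \<open>ennreal\<close>, since they may be infinite.\<close>

definition cache_partition :: "nat \<Rightarrow> (nat \<Rightarrow> real) \<Rightarrow> bool" where
  "cache_partition c p \<longleftrightarrow> (\<forall>i\<in>{1..c}. 0 \<le> p i)"

definition load_function :: "(real \<Rightarrow> ennreal) \<Rightarrow> bool" where
  "load_function f \<longleftrightarrow> antimono_on {0..} f \<and> (\<forall>x\<ge>0. 0 < f x)"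

definition makespan ::
  "('j \<Rightarrow> real \<Rightarrow> ennreal) \<Rightarrow> 'j set \<Rightarrow> nat \<Rightarrow> (nat \<Rightarrow> real) \<Rightarrow> ('j \<Rightarrow> nat) \<Rightarrow> ennreal" where
  "makespan T J c p S = (MAX i\<in>{1..c}. \<Sum>j\<in>{j\<in>J. S j = i}. T j (p i))"

text \<open>\<open>rounded_cache K \<epsilon>\<close> is \<open>K'\<close>, and \<open>partition_pairs K c \<epsilon>\<close> below is \<open>P(K, c, \<epsilon>)\<close>.\<close>

definition rounded_cache :: "real \<Rightarrow> real \<Rightarrow> real" where
  "rounded_cache K \<epsilon> = (1 + \<epsilon>) powi \<lceil>log (1 + \<epsilon>) K\<rceil>"

text \<open>The sequence \<open>l\<^sub>1, \<dots>, l\<^sub>b\<close> is a list indexed from 0, so \<open>l\<^sub>j\<close> is \<open>l ! (j - 1)\<close>, whereas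
  \<open>\<sigma>\<^sub>0, \<dots>, \<sigma>\<^sub>b\<close> is indexed as written. The \<open>\<sigma>\<^sub>j\<close> count cores, so their powers of 2 have
  exponents in \<open>nat\<close>.\<close>

definition cache_level :: "real \<Rightarrow> real \<Rightarrow> nat list \<Rightarrow> nat \<Rightarrow> real" where
  "cache_level K \<epsilon> l j = rounded_cache K \<epsilon> / (1 + \<epsilon>) ^ (l ! (j - 1))"

definition partition_pairs :: "real \<Rightarrow> nat \<Rightarrow> real \<Rightarrow> (nat list \<times> nat list) set" where
  "partition_pairs K c \<epsilon> = {(l, \<sigma>). \<exists>b::nat.
     1 \<le> b \<and> int b \<le> \<lfloor>log 2 (real c)\<rfloor> + 1 \<and>
     length l = b \<and> length \<sigma> = b + 1 \<and>
     (\<forall>j\<in>{1..b}. real (l ! (j - 1)) \<le> log (1 + \<epsilon>) (real c / \<epsilon>) + 1) \<and>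
     sorted_wrt (<) l \<and>
     \<sigma> ! 0 = 0 \<and> (\<forall>j\<in>{1..b}. \<exists>k. \<sigma> ! j = 2 ^ k) \<and>
     sorted_wrt (<) \<sigma> \<and> \<sigma> ! b \<le> c \<and>
     (\<Sum>j=1..b. (real (\<sigma> ! j) - real (\<sigma> ! (j - 1))) * cache_level K \<epsilon> l j)
       \<le> (1 + 5 / 2 * \<epsilon>) * K}"

text \<open>A pair fixes only how many cores get each amount of cache, hence determines a partition up to
  renaming cores. As the \<open>l\<^sub>j\<close> are distinct, the cache levels are distinct and positive, so
  counting the cores at each level is unambiguous.\<close>

definition determined_by ::
  "real \<Rightarrow> nat \<Rightarrow> real \<Rightarrow> nat list \<times> nat list \<Rightarrow> (nat \<Rightarrow> real) \<Rightarrow> bool" where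
  "determined_by K c \<epsilon> = (\<lambda>(l, \<sigma>) p.
     (\<forall>j\<in>{1..length l}.
        card {i\<in>{1..c}. p i = cache_level K \<epsilon> l j} = \<sigma> ! j - \<sigma> ! (j - 1)) \<and>
     card {i\<in>{1..c}. p i = 0} = c - \<sigma> ! length l)"

end

theory Submission
  imports Defs
begin

text \<open>Round the cache of every core up to the next level \<open>K' / (1 + \<epsilon>) ^ l\<close>; this costs at most
  a factor \<open>1 + \<epsilon>\<close> plus, per core, the lowest level, which is at most \<open>(1 + \<epsilon>) \<epsilon> K / c\<close>. With the
  cores sorted by decreasing cache, give each core \<open>n\<close> the rounded cache of the core \<open>2 ^ k\<close>, where
  \<open>2 ^ k\<close> is the least power of 2 with \<open>n \<le> 2 ^ k\<close> (and cache 0 if \<open>2 ^ k > c\<close>). This lowers the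
  caches and makes the numbers of cores at or above each positive level powers of 2. If
  \<open>2 ^ k \<le> i < 2 ^ (k + 1)\<close>, then core \<open>i div 2 + 1\<close> lies in \<open>(2 ^ (k - 1), 2 ^ k]\<close>, so it now has
  at least as much cache as core \<open>i\<close> had. Moving the jobs of every \<open>i\<close> to \<open>i div 2 + 1\<close> merges at
  most two cores, so the makespan grows at most by a factor of 2.\<close>

section \<open>Sorting the cores and counting them by level\<close>

lemma sorting_permutation:
  fixes f :: "nat \<Rightarrow> 'a::linorder"
  obtains \<pi> where "bij_betw \<pi> {1..c} {1..c}" "mono_on {1..c} (\<lambda>i. f (\<pi> i))"
proof -
  define xs where "xs = sort_key f [1..<Suc c]"
  define \<pi> where "\<pi> i = xs ! (i - 1)" for i
  have len: "length xs = c" and set: "set xs = {1..c}" and dist: "distinct xs"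
    and srt: "sorted (map f xs)"
    by (auto simp: xs_def)
  have "bij_betw ((!) xs) {..<c} {1..c}"
    using bij_betw_nth[OF dist] len set by simp
  moreover have "bij_betw (\<lambda>i. i - 1) {1..c} {..<c}"
    by (rule bij_betwI[where g = Suc]) auto
  ultimately have "bij_betw \<pi> {1..c} {1..c}"
    using bij_betw_trans[of "\<lambda>i. i - 1" "{1..c}" "{..<c}" "(!) xs" "{1..c}"]
    by (simp add: \<pi>_def[abs_def] comp_def)
  moreover have "mono_on {1..c} (\<lambda>i. f (\<pi> i))"
  proof (rule mono_onI)
    fix r s assume rs: "r \<in> {1..c}" "s \<in> {1..c}" "r \<le> s"
    then have "map f xs ! (r - 1) \<le> map f xs ! (s - 1)"
      using srt len by (intro sorted_nth_mono) auto
    then show "f (\<pi> r) \<le> f (\<pi> s)" using rs len by (simp add: \<pi>_def)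
  qed
  ultimately show ?thesis by (rule that)
qed

text \<open>Every entry of \<open>l\<close> is attained on \<open>A\<close>, so the cumulative
  counts increase strictly; no value of \<open>h\<close> lies between neighbouring entries, so their
  difference is the size of one level set. With \<open>h\<close> the exponents of the new cache
  levels, this \<open>\<sigma>\<close> becomes the second component of the pair.\<close>

lemma cumulative_counts:
  fixes h :: "'a \<Rightarrow> 'b::linorder"
  assumes "finite A"
  defines "l \<equiv> sorted_list_of_set (h ` A)"
  defines "\<sigma> \<equiv> 0 # map (\<lambda>v. card {i\<in>A. h i \<le> v}) l"
  shows "sorted_wrt (<) \<sigma>"
    and "\<And>j. j \<in> {1..length l} \<Longrightarrow> card {i\<in>A. h i = l ! (j - 1)} = \<sigma> ! j - \<sigma> ! (j - 1)"
    and "\<sigma> ! length l = card A"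
proof -
  have set: "set l = h ` A" and srt: "sorted_wrt (<) l"
    using assms by (auto simp: l_def)
  have less: "l ! i < l ! j" if "i < j" "j < length l" for i j
    using srt that by (simp add: sorted_wrt_iff_nth_less)
  have mem: "\<exists>k<length l. h i = l ! k" if "i \<in> A" for i
    using set that by (metis image_eqI in_set_conv_nth)
  have pos: "0 < card {i\<in>A. h i \<le> v}" if "v \<in> set l" for v
    using that set \<open>finite A\<close> by (auto simp: card_gt_0_iff)
  have strict: "card {i\<in>A. h i \<le> u} < card {i\<in>A. h i \<le> v}" if "u < v" "v \<in> set l" for u v
  proof (rule psubset_card_mono)
    show "finite {i\<in>A. h i \<le> v}" using \<open>finite A\<close> by simp
    from \<open>v \<in> set l\<close> obtain i where "i \<in> A" "h i = v" unfolding set by blast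
    then have "i \<in> {i\<in>A. h i \<le> v} - {i\<in>A. h i \<le> u}" using \<open>u < v\<close> by simp
    moreover have "{i\<in>A. h i \<le> u} \<subseteq> {i\<in>A. h i \<le> v}" using \<open>u < v\<close> by auto
    ultimately show "{i\<in>A. h i \<le> u} \<subset> {i\<in>A. h i \<le> v}" by blast
  qed
  have "sorted_wrt (\<lambda>u v. card {i\<in>A. h i \<le> u} < card {i\<in>A. h i \<le> v}) l"
    by (rule sorted_wrt_mono_rel[OF _ srt]) (rule strict)
  then show "sorted_wrt (<) \<sigma>"
    unfolding \<sigma>_def using pos by (simp add: sorted_wrt_map)
  show "card {i\<in>A. h i = l ! (j - 1)} = \<sigma> ! j - \<sigma> ! (j - 1)" if j: "j \<in> {1..length l}" for j
  \<comment> \<open>The leading 0 shifts \<open>\<sigma>\<close> by one against \<open>l\<close>.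
    For \<open>j = 1\<close> the subtracted entry is that 0, which fits because nothing lies below
    the least value.\<close>
  proof (cases "j = 1")
    case True
    have "l ! 0 \<le> h i" if "i \<in> A" for i
      using mem[OF that] less by (metis gr0I less_imp_le order_refl)
    then have "{i\<in>A. h i = l ! 0} = {i\<in>A. h i \<le> l ! 0}" by force
    moreover have "0 < length l" using j by auto
    ultimately show ?thesis using True by (simp add: \<sigma>_def)
  next
    case False
    then obtain k where k: "j = Suc (Suc k)" "Suc k < length l"
      using j by (auto simp: Suc_le_eq intro: that[of "j - 2"])
    have lt: "l ! k < l ! Suc k" using less k by simp
    have "h i = l ! Suc k \<longleftrightarrow> h i \<le> l ! Suc k \<and> \<not> h i \<le> l ! k" if i: "i \<in> A" for i
    proof -
      obtain n where n: "n < length l" "h i = l ! n" using mem[OF i] by blast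
      consider "n \<le> k" | "n = Suc k" | "n > Suc k" by linarith
      then show ?thesis
      proof cases
        case 1
        then have "l ! n \<le> l ! k" using less[of n k] k by (cases "n = k") auto
        then show ?thesis using n lt by auto
      next
        case 2
        then show ?thesis using n lt by auto
      next
        case 3
        then have "l ! Suc k < l ! n" using less n by simp
        then show ?thesis using n by auto
      qed
    qed
    then have "{i\<in>A. h i = l ! Suc k} = {i\<in>A. h i \<le> l ! Suc k} - {i\<in>A. h i \<le> l ! k}"
      by blast
    moreover have "{i\<in>A. h i \<le> l ! k} \<subseteq> {i\<in>A. h i \<le> l ! Suc k}" using lt by force
    ultimately have "card {i\<in>A. h i = l ! Suc k} =
        card {i\<in>A. h i \<le> l ! Suc k} - card {i\<in>A. h i \<le> l ! k}"
      using \<open>finite A\<close> by (simp add: card_Diff_subset)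
    with k show ?thesis by (simp add: \<sigma>_def)
  qed
  show "\<sigma> ! length l = card A"
  proof (cases "l = []")
    case True
    then show ?thesis using set by (simp add: \<sigma>_def)
  next
    case False
    have "h i \<le> l ! (length l - 1)" if i: "i \<in> A" for i
    proof -
      obtain n where n: "n < length l" "h i = l ! n" using mem[OF i] by blast
      then have "n < length l - 1 \<or> n = length l - 1" by linarith
      then show ?thesis using n less[of n "length l - 1"] by force
    qed
    then have "{i\<in>A. h i \<le> l ! (length l - 1)} = A" by auto
    then show ?thesis using False by (simp add: \<sigma>_def nth_Cons')
  qed
qed

section \<open>Rounding up to powers of 2\<close>

definition log2_up :: "nat \<Rightarrow> nat" where
  "log2_up i = (LEAST k. i \<le> 2 ^ k)"

text \<open>A Galois connection between \<open>log2_up\<close> and the powers of 2; all later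
  reasoning about \<open>log2_up\<close> rests on it.\<close>

lemma log2_up_le_iff: "log2_up i \<le> k \<longleftrightarrow> i \<le> 2 ^ k"
proof
  have "i \<le> 2 ^ i" by (simp add: less_imp_le)
  then have "i \<le> 2 ^ log2_up i" unfolding log2_up_def by (rule LeastI)
  moreover assume "log2_up i \<le> k"
  ultimately show "i \<le> 2 ^ k" by (meson order_trans one_le_numeral power_increasing)
next
  assume "i \<le> 2 ^ k"
  then show "log2_up i \<le> k" unfolding log2_up_def by (rule Least_le)
qed

text \<open>If \<open>2 ^ k \<le> i < 2 ^ (k + 1)\<close>, then
  \<open>i div 2 + 1 \<le> 2 ^ k\<close>. Hence the position whose cache is given to core
  \<open>i div 2 + 1\<close> comes no later than \<open>i\<close> in the sorted order.\<close>

lemma two_power_log2_up_half_le: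
  assumes "1 \<le> i"
  shows "2 ^ log2_up (i div 2 + 1) \<le> i"
proof -
  define k where "k = (GREATEST k::nat. 2 ^ k \<le> i)"
  \<comment> \<open>\<open>GREATEST\<close> is meaningful only if the admissible exponents are
    bounded.\<close>
  have bound: "n \<le> i" if "2 ^ n \<le> i" for n :: nat
    using that by (meson le_trans less_exp less_imp_le)
  have k: "2 ^ k \<le> i"
    unfolding k_def by (rule GreatestI_nat[of _ 0, OF _ bound]) (use assms in auto)
  have "\<not> 2 ^ Suc k \<le> i"
  proof
    assume "2 ^ Suc k \<le> i"
    then have "Suc k \<le> k"
      unfolding k_def by (rule Greatest_le_nat) (rule bound)
    then show False by simp
  qed
  then have "i div 2 + 1 \<le> 2 ^ k" by auto
  then have "log2_up (i div 2 + 1) \<le> k" by (simp add: log2_up_le_iff)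
  then have "(2::nat) ^ log2_up (i div 2 + 1) \<le> 2 ^ k" by (simp add: power_increasing)
  with k show ?thesis by linarith
qed

text \<open>By monotonicity the \<open>n \<le> m\<close> with \<open>g n \<le> v\<close> form an
  initial segment \<open>{..k}\<close>, nonempty because of \<open>k0\<close>; the Galois connection
  turns it into \<open>{1..2 ^ k}\<close>. This makes the entries of \<open>\<sigma>\<close> powers
  of 2.\<close>

lemma card_log2_up_sublevel:
  fixes g :: "nat \<Rightarrow> 'a::preorder"
  assumes "mono_on {..m} g" "k0 \<le> m" "g k0 \<le> v"
  shows "\<exists>k. card {i\<in>{1..2 ^ m}. g (log2_up i) \<le> v} = 2 ^ k"
proof -
  define k where "k = Max {k. k \<le> m \<and> g k \<le> v}"
  have fin: "finite {k. k \<le> m \<and> g k \<le> v}" by simp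
  have "k \<in> {k. k \<le> m \<and> g k \<le> v}"
    unfolding k_def using assms by (intro Max_in) auto
  then have k: "k \<le> m" "g k \<le> v" by auto
  have "n \<le> k" if "n \<le> m" "g n \<le> v" for n
    unfolding k_def using that fin by (intro Max_ge) auto
  moreover have "g n \<le> v" if "n \<le> k" for n
    using mono_onD[OF assms(1), of n k] k that by (auto intro: order_trans)
  ultimately have "g n \<le> v \<longleftrightarrow> n \<le> k" if "n \<le> m" for n using that by blast
  then have "i \<in> {1..2 ^ m} \<and> g (log2_up i) \<le> v \<longleftrightarrow> i \<in> {1..2 ^ k}" for i
    using k(1) log2_up_le_iff[of i m] log2_up_le_iff[of i k] by auto
  then have "{i\<in>{1..2 ^ m}. g (log2_up i) \<le> v} = {1..2 ^ k}" by blast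
  then show ?thesis by (intro exI[of _ k]) simp
qed

section \<open>Rounding amounts of cache up to levels\<close>

lemma rounded_cache_bounds:
  assumes "0 < \<epsilon>" "0 < K"
  shows "K \<le> rounded_cache K \<epsilon>" "rounded_cache K \<epsilon> \<le> (1 + \<epsilon>) * K"
proof -
  let ?x = "log (1 + \<epsilon>) K"
  have eq: "rounded_cache K \<epsilon> = (1 + \<epsilon>) powr \<lceil>?x\<rceil>"
    using assms by (simp add: rounded_cache_def powr_real_of_int')
  have K: "(1 + \<epsilon>) powr ?x = K" using assms by simp
  have "(1 + \<epsilon>) powr ?x \<le> (1 + \<epsilon>) powr \<lceil>?x\<rceil>"
    using assms by (intro powr_mono) auto
  then show "K \<le> rounded_cache K \<epsilon>" using K eq by simp
  have "(1 + \<epsilon>) powr \<lceil>?x\<rceil> \<le> (1 + \<epsilon>) powr (1 + ?x)"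
    using assms by (intro powr_mono) linarith+
  also have "\<dots> = (1 + \<epsilon>) * K" using assms K by (simp add: powr_add)
  finally show "rounded_cache K \<epsilon> \<le> (1 + \<epsilon>) * K" using eq by simp
qed

text \<open>Take for \<open>r i\<close> the largest admissible exponent whose level still covers
  \<open>p i\<close>. Either the next level is below \<open>p i\<close>, and the loss is at most a
  factor \<open>1 + \<epsilon>\<close>, or \<open>r i\<close> is the last exponent, and its level is
  at most the additive term.\<close>

lemma cache_rounding:
  assumes "0 < \<epsilon>" "\<epsilon> < 1" "1 \<le> c" "0 < K" and p: "\<forall>i\<in>I. 0 \<le> p i \<and> p i \<le> K"
  obtains r :: "'i \<Rightarrow> nat" where
    "\<And>i. i \<in> I \<Longrightarrow> real (r i) \<le> log (1 + \<epsilon>) (real c / \<epsilon>) + 1"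
    "\<And>i. i \<in> I \<Longrightarrow> p i \<le> rounded_cache K \<epsilon> / (1 + \<epsilon>) ^ r i"
    "\<And>i. i \<in> I \<Longrightarrow>
       rounded_cache K \<epsilon> / (1 + \<epsilon>) ^ r i \<le> (1 + \<epsilon>) * p i + (1 + \<epsilon>) * \<epsilon> * K / real c"
proof -
  define lv where "lv n = rounded_cache K \<epsilon> / (1 + \<epsilon>) ^ n" for n
  define y where "y = log (1 + \<epsilon>) (real c / \<epsilon>)"
  \<comment> \<open>The largest exponent allowed in a pair. The summand 1 ensures
    \<open>L \<ge> y\<close>, hence \<open>(1 + \<epsilon>) ^ L \<ge> c / \<epsilon>\<close>, which
    makes the lowest level small; since \<open>y \<ge> 0\<close>, \<open>nat\<close> truncates
    nothing.\<close>
  define L where "L = nat \<lfloor>y + 1\<rfloor>"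
  define r where "r i = Max {n. n \<le> L \<and> p i \<le> lv n}" for i
  have "0 \<le> y" unfolding y_def using assms by (subst zero_le_log_cancel_iff) auto
  then have L: "real L \<le> y + 1" "y \<le> real L" unfolding L_def by linarith+
  have "real c / \<epsilon> = (1 + \<epsilon>) powr y" using assms by (simp add: y_def)
  also have "\<dots> \<le> (1 + \<epsilon>) powr real L" using assms L by (intro powr_mono) auto
  also have "\<dots> = (1 + \<epsilon>) ^ L" using assms by (simp add: powr_realpow)
  finally have pow: "real c / \<epsilon> \<le> (1 + \<epsilon>) ^ L" .
  note K' = rounded_cache_bounds[OF \<open>0 < \<epsilon>\<close> \<open>0 < K\<close>]
  have "lv L \<le> ((1 + \<epsilon>) * K) / (real c / \<epsilon>)"
    unfolding lv_def using K' pow assms by (intro frac_le) auto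
  then have low: "lv L \<le> (1 + \<epsilon>) * \<epsilon> * K / real c" using assms by (simp add: field_simps)
  have r: "r i \<le> L" "p i \<le> lv (r i)" "\<And>n. n \<le> L \<Longrightarrow> p i \<le> lv n \<Longrightarrow> n \<le> r i" if "i \<in> I" for i
  proof -
    have fin: "finite {n. n \<le> L \<and> p i \<le> lv n}" by simp
    \<comment> \<open>Level 0 is \<open>K' \<ge> K\<close>, so it covers every core.\<close>
    have "0 \<in> {n. n \<le> L \<and> p i \<le> lv n}" using p K' that by (auto simp: lv_def)
    then have "r i \<in> {n. n \<le> L \<and> p i \<le> lv n}"
      unfolding r_def by (intro Max_in fin) auto
    then show "r i \<le> L" "p i \<le> lv (r i)" by auto
    show "n \<le> r i" if "n \<le> L" "p i \<le> lv n" for n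
      unfolding r_def using that by (intro Max_ge fin) auto
  qed
  show ?thesis
  proof (rule that[of r])
    fix i assume i: "i \<in> I"
    show "real (r i) \<le> log (1 + \<epsilon>) (real c / \<epsilon>) + 1"
      using r(1)[OF i] L unfolding y_def[symmetric] by linarith
    show "p i \<le> rounded_cache K \<epsilon> / (1 + \<epsilon>) ^ r i" using r(2)[OF i] by (simp add: lv_def)
    have nonneg: "0 \<le> (1 + \<epsilon>) * p i" "0 \<le> (1 + \<epsilon>) * \<epsilon> * K / real c"
      using p i assms by auto
    show "rounded_cache K \<epsilon> / (1 + \<epsilon>) ^ r i \<le> (1 + \<epsilon>) * p i + (1 + \<epsilon>) * \<epsilon> * K / real c"
    proof (cases "r i = L")
      case True
      then show ?thesis using low nonneg by (simp add: lv_def)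
    next
      case False
      then have "lv (Suc (r i)) < p i" using r(1)[OF i] r(3)[OF i, of "Suc (r i)"] by force
      then have "(1 + \<epsilon>) * lv (Suc (r i)) \<le> (1 + \<epsilon>) * p i" using assms by simp
      moreover have "(1 + \<epsilon>) * lv (Suc (r i)) = lv (r i)" using assms by (simp add: lv_def)
      ultimately show ?thesis using nonneg by (simp add: lv_def)
    qed
  qed
qed

section \<open>Effect of merging cores on the makespan\<close>

lemma makespan_merge:
  assumes "finite J" "1 \<le> c" and S: "S \<in> J \<rightarrow> {1..c}"
    and F: "F \<in> {1..c} \<rightarrow> {1..c}"
    and card: "\<And>n. n \<in> {1..c} \<Longrightarrow> card {i\<in>{1..c}. F i = n} \<le> d"
    and T: "\<And>j. j \<in> J \<Longrightarrow> T j (p' (F (S j))) \<le> T j (p (S j))"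
  shows "makespan T J c p' (\<lambda>j. F (S j)) \<le> of_nat d * makespan T J c p S"
proof -
  define M where "M = makespan T J c p S"
  have le: "(\<Sum>j\<in>{j\<in>J. S j = i}. T j (p i)) \<le> M" if "i \<in> {1..c}" for i
    unfolding M_def makespan_def using that by (intro Max_ge) auto
  have "(\<Sum>j\<in>{j\<in>J. F (S j) = n}. T j (p' n)) \<le> of_nat d * M" if n: "n \<in> {1..c}" for n
  proof -
    let ?I = "{i\<in>{1..c}. F i = n}"
    let ?J = "{j\<in>J. F (S j) = n}"
    have "(\<Sum>j\<in>?J. T j (p' n)) \<le> (\<Sum>j\<in>?J. T j (p (S j)))"
      using T by (intro sum_mono) auto
    \<comment> \<open>Group the jobs now on \<open>n\<close> by their former core: there are at most
      \<open>d\<close> groups, each of load at most \<open>M\<close>.\<close>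
    also have "\<dots> = (\<Sum>i\<in>?I. \<Sum>j\<in>{j\<in>?J. S j = i}. T j (p (S j)))"
      using \<open>finite J\<close> S by (intro sum.group[symmetric]) auto
    also have "\<dots> = (\<Sum>i\<in>?I. \<Sum>j\<in>{j\<in>J. S j = i}. T j (p i))"
      by (intro sum.cong) auto
    also have "\<dots> \<le> (\<Sum>i\<in>?I. M)" using le by (intro sum_mono) auto
    also have "\<dots> = of_nat (card ?I) * M" by simp
    also have "\<dots> \<le> of_nat d * M" using card[OF n] by (intro mult_right_mono) auto
    finally show ?thesis .
  qed
  then show ?thesis
    unfolding M_def[symmetric] by (subst makespan_def) (use \<open>1 \<le> c\<close> in auto)
qed

theorem theorem3:
  fixes \<epsilon> K :: real and c :: nat and J :: "'j set"
    and T :: "'j \<Rightarrow> real \<Rightarrow> ennreal" and p :: "nat \<Rightarrow> real" and S :: "'j \<Rightarrow> nat"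
  assumes "0 < \<epsilon>" and "\<epsilon> < 1 / 2" and "1 \<le> c" and "0 < K"
    and "finite J" and "\<And>j. j \<in> J \<Longrightarrow> load_function (T j)"
    and "cache_partition c p" and "(\<Sum>i=1..c. p i) \<le> K"
    and "S \<in> J \<rightarrow> {1..c}"
  shows "\<exists>q p' S'. q \<in> partition_pairs K c \<epsilon> \<and> cache_partition c p' \<and> determined_by K c \<epsilon> q p' \<and>
           S' \<in> J \<rightarrow> {1..c} \<and> makespan T J c p' S' \<le> 9 * makespan T J c p S"
proof -

  \<comment> \<open>Construction of the pair and of the new partition\<close>
  have p0: "0 \<le> p i" if "i \<in> {1..c}" for i
    using assms(7) that by (auto simp: cache_partition_def)
  have pK: "p i \<le> K" if "i \<in> {1..c}" for i
    using member_le_sum[of i "{1..c}" p] that p0 assms(8) by force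
  define lv where "lv n = rounded_cache K \<epsilon> / (1 + \<epsilon>) ^ n" for n
  have "0 < rounded_cache K \<epsilon>" using rounded_cache_bounds(1)[of \<epsilon> K] assms by linarith
  then have lv_pos: "0 < lv n" for n using assms by (simp add: lv_def)
  have lv_le: "lv n \<le> lv n'" if "n' \<le> n" for n n'
    unfolding lv_def using that assms \<open>0 < rounded_cache K \<epsilon>\<close>
    by (intro divide_left_mono power_increasing) auto
  have lv_less: "lv n < lv n'" if "n' < n" for n n'
    unfolding lv_def using that assms \<open>0 < rounded_cache K \<epsilon>\<close>
    by (intro divide_strict_left_mono power_strict_increasing) auto
  have lv_inj: "lv n = lv n' \<longleftrightarrow> n = n'" for n n'
    using lv_less by (metis less_irrefl linorder_neqE_nat)
  obtain r where r_le: "\<And>i. i \<in> {1..c} \<Longrightarrow> real (r i) \<le> log (1 + \<epsilon>) (real c / \<epsilon>) + 1"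
    and r_ge: "\<And>i. i \<in> {1..c} \<Longrightarrow> p i \<le> lv (r i)"
    and r_cost: "\<And>i. i \<in> {1..c} \<Longrightarrow> lv (r i) \<le> (1 + \<epsilon>) * p i + (1 + \<epsilon>) * \<epsilon> * K / real c"
    using cache_rounding[of \<epsilon> c K "{1..c}" p] assms p0 pK unfolding lv_def by auto
  \<comment> \<open>Larger exponents mean less cache, so \<open>\<pi>\<close> lists the cores by
    decreasing rounded cache.\<close>
  obtain \<pi> where \<pi>: "bij_betw \<pi> {1..c} {1..c}" and mono: "mono_on {1..c} (\<lambda>i. r (\<pi> i))"
    by (rule sorting_permutation)
  have \<pi>_in: "\<pi> i \<in> {1..c}" if "i \<in> {1..c}" for i using \<pi> that by (auto dest: bij_betwE)
  \<comment> \<open>\<open>2 ^ m\<close> is the largest power of 2 up to \<open>c\<close>, and will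
    be the number of cores with positive cache.\<close>
  define m where "m = nat \<lfloor>log 2 (real c)\<rfloor>"
  have "0 \<le> log 2 (real c)" using assms by simp
  then have m: "int m = \<lfloor>log 2 (real c)\<rfloor>" by (simp add: m_def)
  have m_iff: "2 ^ k \<le> c \<longleftrightarrow> k \<le> m" for k
  proof -
    have "2 ^ k \<le> c \<longleftrightarrow> (2::real) ^ k \<le> real c"
      by (metis of_nat_le_iff of_nat_numeral of_nat_power)
    also have "\<dots> \<longleftrightarrow> real k \<le> log 2 (real c)"
      using assms by (subst le_log_iff) (auto simp: powr_realpow)
    also have "\<dots> \<longleftrightarrow> k \<le> m" using m by linarith
    finally show ?thesis .
  qed
  have pow_in: "2 ^ k \<in> {1..c}" if "k \<le> m" for k using that m_iff by simp
  define g where "g k = r (\<pi> (2 ^ k))" for k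
  define h where "h i = g (log2_up i)" for i
  define A where "A = {1..(2::nat) ^ m}"
  define l where "l = sorted_list_of_set (h ` A)"
  define \<sigma> where "\<sigma> = 0 # map (\<lambda>v. card {i\<in>A. h i \<le> v}) l"
  \<comment> \<open>\<open>p'\<close> is indexed by positions in the sorted order, not by original
    cores. For \<open>i > 2 ^ m\<close> the position \<open>2 ^ log2_up i\<close> would exceed
    \<open>c\<close>, hence the cache 0.\<close>
  define p' where "p' i = (if i \<le> 2 ^ m then lv (h i) else 0)" for i
  have finA: "finite A" "A \<noteq> {}" and cardA: "card A = 2 ^ m" by (auto simp: A_def)
  have A_sub: "A \<subseteq> {1..c}" using m_iff[of m] by (auto simp: A_def)
  note counts = cumulative_counts[OF finA(1), where h = h, folded l_def, folded \<sigma>_def]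
  have g_mono: "mono_on {..m} g"
    unfolding g_def using pow_in by (intro mono_onI mono_onD[OF mono]) auto
  have log2_A: "log2_up i \<le> m" if "i \<in> A" for i
    using that by (simp add: A_def log2_up_le_iff)
  have setl: "set l = h ` A" and dl: "distinct l" and srtl: "sorted_wrt (<) l"
    and lenl: "length l = card (h ` A)"
    using finA by (auto simp: l_def)
  have l_mem: "\<exists>i\<in>A. l ! (j - 1) = h i" if "j \<in> {1..length l}" for j
    using nth_mem[of "j - 1" l] that setl by auto
  have lvl: "cache_level K \<epsilon> l j = lv (l ! (j - 1))" for j
    by (simp add: cache_level_def lv_def)
  have len\<sigma>: "length \<sigma> = length l + 1" by (simp add: \<sigma>_def)
  have \<sigma>_mono: "\<sigma> ! (j - 1) \<le> \<sigma> ! j" if "j \<in> {1..length l}" for j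
    using sorted_wrt_nth_less[OF counts(1), of "j - 1" j] that len\<sigma> by auto

  \<comment> \<open>Membership of the pair in \<open>P(K, c, \<epsilon>)\<close>\<close>
  have "length l \<le> m + 1"
  proof -
    have "h ` A \<subseteq> g ` {..m}" using log2_A by (auto simp: h_def)
    then have "card (h ` A) \<le> card (g ` {..m})" by (intro card_mono) auto
    also have "\<dots> \<le> m + 1" using card_image_le[of "{..m}" g] by simp
    finally show ?thesis using lenl by simp
  qed
  then have b_le: "int (length l) \<le> \<lfloor>log 2 (real c)\<rfloor> + 1" using m by linarith
  have b_ge: "1 \<le> length l" using lenl finA by (simp add: Suc_le_eq card_gt_0_iff)
  have l_le: "real (l ! (j - 1)) \<le> log (1 + \<epsilon>) (real c / \<epsilon>) + 1" if "j \<in> {1..length l}" for j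
  proof -
    obtain i where "i \<in> A" "l ! (j - 1) = h i" using l_mem[OF \<open>j \<in> _\<close>] by blast
    then show ?thesis using r_le[OF \<pi>_in[OF pow_in[OF log2_A]]] by (simp add: h_def g_def)
  qed
  have pow2: "\<exists>k. \<sigma> ! j = 2 ^ k" if j: "j \<in> {1..length l}" for j
  proof -
    obtain i where i: "i \<in> A" "l ! (j - 1) = h i" using l_mem[OF j] by blast
    \<comment> \<open>The value \<open>l ! (j - 1)\<close> is attained by \<open>g\<close> at
      \<open>log2_up i\<close>, so the sublevel set is nonempty.\<close>
    have "\<exists>k. card {i\<in>{1..2 ^ m}. g (log2_up i) \<le> l ! (j - 1)} = 2 ^ k"
      using i log2_A by (intro card_log2_up_sublevel[OF g_mono, of "log2_up i"]) (auto simp: h_def)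
    moreover have "j - 1 < length l" using j by auto
    ultimately show ?thesis using j by (simp add: \<sigma>_def A_def h_def nth_Cons')
  qed
  have cost: "(\<Sum>j=1..length l. (real (\<sigma> ! j) - real (\<sigma> ! (j - 1))) * cache_level K \<epsilon> l j)
      \<le> (1 + 5 / 2 * \<epsilon>) * K"
  proof -
    \<comment> \<open>Multiplicity times level, summed over the distinct levels, regroups into the
      total cache of the positions in \<open>A\<close>.\<close>
    have "(\<Sum>j=1..length l. (real (\<sigma> ! j) - real (\<sigma> ! (j - 1))) * cache_level K \<epsilon> l j)
        = (\<Sum>j=1..length l. real (card {i\<in>A. h i = l ! (j - 1)}) * lv (l ! (j - 1)))"
      using counts(2) \<sigma>_mono by (intro sum.cong) (auto simp: lvl of_nat_diff)
    also have "\<dots> = (\<Sum>j<length l. real (card {i\<in>A. h i = l ! j}) * lv (l ! j))"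
      by (intro sum.reindex_bij_witness[where i = Suc and j = "\<lambda>j. j - 1"]) auto
    also have "\<dots> = (\<Sum>v\<in>h ` A. real (card {i\<in>A. h i = v}) * lv v)"
      using sum.reindex_bij_betw[OF bij_betw_nth[OF dl refl setl[symmetric]],
          of "\<lambda>v. real (card {i\<in>A. h i = v}) * lv v"] by simp
    also have "\<dots> = (\<Sum>v\<in>h ` A. \<Sum>i\<in>{i\<in>A. h i = v}. lv (h i))"
      by (intro sum.cong) auto
    also have "\<dots> = (\<Sum>i\<in>A. lv (h i))" using finA by (intro sum.group) auto
    also have "\<dots> \<le> (\<Sum>i\<in>A. lv (r (\<pi> i)))"
    proof (rule sum_mono)
      fix i assume i: "i \<in> A"
      \<comment> \<open>As \<open>i \<le> 2 ^ log2_up i\<close>, the reference position comes no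
        earlier and has no more cache.\<close>
      have "r (\<pi> i) \<le> r (\<pi> (2 ^ log2_up i))"
        using i A_sub pow_in[OF log2_A[OF i]] log2_up_le_iff[of i "log2_up i"]
        by (intro mono_onD[OF mono]) auto
      then show "lv (h i) \<le> lv (r (\<pi> i))" by (intro lv_le) (simp add: h_def g_def)
    qed
    also have "\<dots> \<le> (\<Sum>i=1..c. lv (r (\<pi> i)))"
      using A_sub lv_pos by (intro sum_mono2) (auto intro: less_imp_le)
    also have "\<dots> = (\<Sum>i=1..c. lv (r i))" by (rule sum.reindex_bij_betw[OF \<pi>])
    also have "\<dots> \<le> (\<Sum>i=1..c. (1 + \<epsilon>) * p i + (1 + \<epsilon>) * \<epsilon> * K / real c)"
      using r_cost by (intro sum_mono) auto
    also have "\<dots> = (1 + \<epsilon>) * (\<Sum>i=1..c. p i) + (1 + \<epsilon>) * \<epsilon> * K"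
      using assms by (simp add: sum.distrib sum_distrib_left)
    also have "\<dots> \<le> (1 + \<epsilon>) * K + (1 + \<epsilon>) * \<epsilon> * K" using assms by simp
    also have "\<dots> = (1 + 2 * \<epsilon> + \<epsilon> * \<epsilon>) * K" by (simp add: algebra_simps)
    \<comment> \<open>Here \<open>\<epsilon> < 1 / 2\<close> gives
      \<open>\<epsilon> * \<epsilon> \<le> \<epsilon> / 2\<close>, whence the constant
      \<open>5 / 2\<close>.\<close>
    also have "\<dots> \<le> (1 + 5 / 2 * \<epsilon>) * K"
      using mult_left_mono[of \<epsilon> "1 / 2" \<epsilon>] assms by (intro mult_right_mono) auto
    finally show ?thesis .
  qed
  have "\<sigma> ! length l \<le> c" using counts(3) cardA m_iff[of m] by simp
  then have pairs: "(l, \<sigma>) \<in> partition_pairs K c \<epsilon>"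
    unfolding partition_pairs_def
    using b_ge b_le len\<sigma> l_le srtl pow2 counts(1) cost by (auto simp: \<sigma>_def)

  \<comment> \<open>The partition determined by the pair\<close>
  have det: "determined_by K c \<epsilon> (l, \<sigma>) p'"
  proof -
    \<comment> \<open>Injectivity of \<open>lv\<close> identifies levels with exponents; positivity
      keeps cores without cache out of every level.\<close>
    have "{i\<in>{1..c}. p' i = lv v} = {i\<in>A. h i = v}" for v
      using lv_pos[of v] A_sub lv_inj by (auto simp: p'_def A_def split: if_splits)
    moreover have "{i\<in>{1..c}. p' i = 0} = {1..c} - A"
      using lv_pos by (auto simp: p'_def A_def less_imp_neq[THEN not_sym])
    then have "card {i\<in>{1..c}. p' i = 0} = c - 2 ^ m"
      using A_sub finA cardA by (simp add: card_Diff_subset)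
    ultimately show ?thesis
      using counts(2,3) cardA by (simp add: determined_by_def lvl)
  qed
  have part: "cache_partition c p'"
    using lv_pos by (simp add: cache_partition_def p'_def less_imp_le)

  \<comment> \<open>The new job assignment and its makespan\<close>
  define \<rho> where "\<rho> = inv_into {1..c} \<pi>"
  have \<rho>: "bij_betw \<rho> {1..c} {1..c}" unfolding \<rho>_def by (rule bij_betw_inv_into[OF \<pi>])
  have \<rho>_in: "\<rho> i \<in> {1..c}" and \<pi>\<rho>: "\<pi> (\<rho> i) = i" if "i \<in> {1..c}" for i
    using \<rho> that bij_betw_inv_into_right[OF \<pi> that] by (auto simp: \<rho>_def dest: bij_betwE)
  \<comment> \<open>\<open>\<rho> i\<close> is the position of the original core \<open>i\<close>;
    halving is applied to positions.\<close>
  define F where "F i = \<rho> i div 2 + 1" for i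
  have F_in: "F \<in> {1..c} \<rightarrow> {1..c}"
  proof (rule funcsetI)
    fix i assume "i \<in> {1..c}"
    then have "\<rho> i \<in> {1..c}" by (rule \<rho>_in)
    then show "F i \<in> {1..c}" by (auto simp: F_def)
  qed
  have F_card: "card {i\<in>{1..c}. F i = n} \<le> 2" for n
  proof -
    have "card {i\<in>{1..c}. F i = n} = card (\<rho> ` {i\<in>{1..c}. F i = n})"
      by (rule card_image[OF inj_on_subset[OF bij_betw_imp_inj_on[OF \<rho>]], symmetric]) blast
    \<comment> \<open>Truncated subtraction is harmless: \<open>F i \<ge> 1\<close>, so for
      \<open>n = 0\<close> the left side is empty.\<close>
    moreover have "\<rho> ` {i\<in>{1..c}. F i = n} \<subseteq> {2 * n - 2, 2 * n - 1}"
    proof (rule image_subsetI)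
      fix i assume "i \<in> {i\<in>{1..c}. F i = n}"
      then have "\<rho> i div 2 + 1 = n" by (simp add: F_def)
      then have "\<rho> i = 2 * n - 2 \<or> \<rho> i = 2 * n - 1" by presburger
      then show "\<rho> i \<in> {2 * n - 2, 2 * n - 1}" by simp
    qed
    then have "card (\<rho> ` {i\<in>{1..c}. F i = n}) \<le> card {2 * n - 2, 2 * n - 1}"
      by (rule card_mono[rotated]) simp
    moreover have "card {2 * n - 2, 2 * n - 1} \<le> 2" by (simp add: card_insert_if)
    ultimately show ?thesis by linarith
  qed
  \<comment> \<open>The reference position of \<open>F i\<close> is at most \<open>\<rho> i\<close>,
    so its rounded cache is at least that of core \<open>i\<close>, which covers \<open>p i\<close>.
    It is also at most \<open>c\<close>, so \<open>F i\<close> falls in the nonzero branch of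
    \<open>p'\<close>.\<close>
  have "p i \<le> p' (F i)" if i: "i \<in> {1..c}" for i
  proof -
    have pow: "2 ^ log2_up (F i) \<le> \<rho> i"
      unfolding F_def using \<rho>_in[OF i] by (intro two_power_log2_up_half_le) auto
    then have le: "log2_up (F i) \<le> m" using \<rho>_in[OF i] m_iff[of "log2_up (F i)"] by auto
    have "r (\<pi> (2 ^ log2_up (F i))) \<le> r (\<pi> (\<rho> i))"
      using pow pow_in[OF le] \<rho>_in[OF i] by (intro mono_onD[OF mono]) auto
    then have "lv (r i) \<le> lv (h (F i))" using \<pi>\<rho>[OF i] by (intro lv_le) (simp add: h_def g_def)
    then show ?thesis using r_ge[OF i] le by (simp add: p'_def log2_up_le_iff)
  qed
  then have T_le: "T j (p' (F (S j))) \<le> T j (p (S j))" if j: "j \<in> J" for j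
    using assms(6)[OF j] p0[of "S j"] funcset_mem[OF assms(9) j]
    unfolding load_function_def
    by (intro monotone_onD[of "{0..}" "(\<le>)" "(\<ge>)" "T j"]) (auto intro: order_trans)
  have "makespan T J c p' (\<lambda>j. F (S j)) \<le> of_nat 2 * makespan T J c p S"
    using assms F_in F_card T_le by (intro makespan_merge) auto
  \<comment> \<open>Merging at most two cores gives the factor 2, which is weakened to 9.\<close>
  also have "\<dots> \<le> 9 * makespan T J c p S" by (intro mult_right_mono) auto
  finally have "makespan T J c p' (\<lambda>j. F (S j)) \<le> 9 * makespan T J c p S" .
  moreover have "(\<lambda>j. F (S j)) \<in> J \<rightarrow> {1..c}" using F_in assms(9) by auto
  ultimately show ?thesis using pairs det part by blast
qed

end
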